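(* Let $w_1=(1,0)$, $w_2=(0,1)$, $w_3=(1,1)$, $w_4=(-1,1)$. For $1\le k\leq 4$, the system $w_1,\dots,w_k$ of curves on the torus is minimal, i.e. $\mathrm{cr}(w_1,\dots,w_k)=\mathrm{cr}(k;1)$; explicitly \[\mathrm{cr}(1;1)=0,\quad \mathrm{cr}(2;1)=1,\quad \mathrm{cr}(3;1)=3,\quad \mathrm{cr}(4;1)=7.\] Moreover, for any other minimal system $v_1,\dots,v_k\in\mathbb{Z}^2$ of $k$ curves there exists $A\in\mathrm{SL}_2(\mathbb{Z})$ such that $\{Av_1,\dots,Av_k\}=\{w_1,\dots,w_k\}$, as sets of curves (vectors being identified up to sign).
   Context: Let $\Sigma_1$ be the torus. Isotopy classes of non-contractible, oriented simple closed curves on $\Sigma_1$ correspond bijectively to primitive vectors in $\mathbb{Z}^2$. Only unoriented curves are considered, so $(a,b)$ and $(-a,-b)$ represent the same curve; primitive vectors up to sign are called curves. The geometric intersection number is $i((a,b),(c,d))=|ad-bc|$. A system of $k$ curves consists of $k$ pairwise non-homotopic curves, i.e. primitive vectors $v_1,\dots,v_k\in\mathbb{Z}^2$ with $v_i\ne\pm v_j$ for $i\neq j$. Its crossing number is $\mathrm{cr}(v_1,\dots,v_k)=\sum_{1\le i<j\le k}i(v_i,v_j)$; $\mathrm{cr}(k;1)$ is the minimum of the crossing number over all systems of $k$ curves on the torus, and a system attaining it is called minimal. $\mathrm{SL}_2(\mathbb{Z})$ (the mapping class group of the torus) acts on $\mathbb{Z}^2$ by left multiplication on column vectors. *)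

theory Defs
  imports "HOL-Analysis.Analysis"
begin

text \<open>
  Isotopy classes of non-contractible oriented simple closed curves on the torus are identified
  with primitive vectors in the integer lattice of rank 2; forgetting the orientation identifies
  a vector with its negative.
\<close>

definition primitive :: "int ^ 2 \<Rightarrow> bool" where
  "primitive v \<longleftrightarrow> coprime (v $ 1) (v $ 2)"

definition curve :: "int ^ 2 \<Rightarrow> (int ^ 2) set" where
  "curve v = {v, - v}"

definition intersection_number :: "int ^ 2 \<Rightarrow> int ^ 2 \<Rightarrow> nat" where
  "intersection_number u v = nat \<bar>u $ 1 * v $ 2 - u $ 2 * v $ 1\<bar>"

text \<open>
  A system of \<open>k\<close> curves is indexed by \<open>{1..k}\<close>; values of \<open>v\<close> at other indices are irrelevant.
\<close>

definition curve_system :: "nat \<Rightarrow> (nat \<Rightarrow> int ^ 2) \<Rightarrow> bool" where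
  "curve_system k v \<longleftrightarrow>
     (\<forall>i\<in>{1..k}. primitive (v i)) \<and>
     (\<forall>i\<in>{1..k}. \<forall>j\<in>{1..k}. i \<noteq> j \<longrightarrow> curve (v i) \<noteq> curve (v j))"

definition crossing_number :: "nat \<Rightarrow> (nat \<Rightarrow> int ^ 2) \<Rightarrow> nat" where
  "crossing_number k v = (\<Sum>j\<in>{1..k}. \<Sum>i\<in>{1..<j}. intersection_number (v i) (v j))"

text \<open>
  The number usually written \<open>cr(k; 1)\<close>, where \<open>1\<close> is the genus. The minimum exists because
  systems of any size exist, for instance \<open>(1, 1), \<dots>, (1, k)\<close>.
\<close>

definition cr_torus :: "nat \<Rightarrow> nat" where
  "cr_torus k = (LEAST n. \<exists>v. curve_system k v \<and> crossing_number k v = n)"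

definition minimal_system :: "nat \<Rightarrow> (nat \<Rightarrow> int ^ 2) \<Rightarrow> bool" where
  "minimal_system k v \<longleftrightarrow> curve_system k v \<and> crossing_number k v = cr_torus k"

definition SL2Z :: "(int ^ 2 ^ 2) set" where
  "SL2Z = {A. det A = 1}"

end

theory Submission
  imports Defs
begin

text \<open>
  Distinct curves cross at least once, so every crossing number is at least \<open>k choose 2\<close>.
  Two curves crossing exactly once are carried by \<open>SL\<^sub>2(\<int>)\<close> to \<open>(1, 0)\<close> and \<open>(0, 1)\<close>; every
  further curve crossing both of them once is then \<open>(1, 1)\<close> or \<open>(-1, 1)\<close>, and these two cross
  twice. Hence four curves cannot cross pairwise once, and a system of four curves with at most
  seven crossings has exactly one pair crossing twice, whose complementary pair can be normalised.
\<close>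

section \<open>Intersection numbers and the action of the modular group\<close>

lemma int_vec2_eq_iff: "u = v \<longleftrightarrow> u $ 1 = v $ 1 \<and> u $ 2 = v $ 2" for u v :: "int ^ 2"
  by (simp add: vec_eq_iff forall_2)

lemma matrix_vector_mult_2:
  "(A *v x) $ i = A $ i $ 1 * x $ 1 + A $ i $ 2 * x $ 2" for A :: "int ^ 2 ^ 2"
  by (simp add: matrix_vector_mult_def sum_2)

lemma curve_eq_iff: "curve u = curve v \<longleftrightarrow> u = v \<or> u = - v"
  by (auto simp: curve_def doubleton_eq_iff)

lemma intersection_number_commute: "intersection_number u v = intersection_number v u"
  by (simp add: intersection_number_def abs_minus_commute mult.commute)

text \<open>Signs disappear in the absolute value. This lets normal forms known only up to sign be
  substituted into intersection numbers.\<close>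

lemma intersection_number_cong:
  assumes "curve u = curve u'" and "curve v = curve v'"
  shows "intersection_number u v = intersection_number u' v'"
  using assms by (auto simp: curve_eq_iff intersection_number_def abs_minus_commute)

text \<open>The intersection number is the absolute determinant of the matrix with columns
  \<open>u\<close> and \<open>v\<close>, and determinants are multiplicative.\<close>

lemma intersection_number_SL2Z:
  assumes "A \<in> SL2Z"
  shows "intersection_number (A *v u) (A *v v) = intersection_number u v"
proof -
  have "(A *v u) $ 1 * (A *v v) $ 2 - (A *v u) $ 2 * (A *v v) $ 1
      = det A * (u $ 1 * v $ 2 - u $ 2 * v $ 1)"
    by (simp add: det_2 matrix_vector_mult_2 algebra_simps)
  then show ?thesis
    using assms by (simp add: intersection_number_def SL2Z_def)
qed

lemma curve_SL2Z_cancel: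
  assumes "A \<in> SL2Z" and "curve (A *v u) = curve (A *v v)"
  shows "curve u = curve v"
proof -
  \<comment> \<open>\<open>B\<close> is the adjugate of \<open>A\<close>, which is its inverse since
    \<open>det A = 1\<close>.\<close>
  define B :: "int ^ 2 ^ 2" where
    "B = vector [vector [A $ 2 $ 2, - A $ 1 $ 2], vector [- A $ 2 $ 1, A $ 1 $ 1]]"
  have det: "A $ 1 $ 1 * A $ 2 $ 2 - A $ 1 $ 2 * A $ 2 $ 1 = 1"
    using assms(1) by (simp add: SL2Z_def det_2)
  have inv: "B *v (A *v x) = x" for x
  proof -
    have "B *v (A *v x) = (A $ 1 $ 1 * A $ 2 $ 2 - A $ 1 $ 2 * A $ 2 $ 1) *s x"
      by (simp add: B_def int_vec2_eq_iff matrix_vector_mult_2 algebra_simps)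
    then show ?thesis by (simp add: det)
  qed
  have neg: "B *v - y = - (B *v y)" for y
    by (simp add: int_vec2_eq_iff matrix_vector_mult_2)
  show ?thesis
    using assms(2) inv neg unfolding curve_eq_iff by metis
qed

text \<open>Zero determinant means proportional vectors, and proportional primitive vectors agree up
  to sign.\<close>

lemma intersection_number_pos:
  assumes "primitive u" and "primitive v" and "curve u \<noteq> curve v"
  shows "intersection_number u v \<ge> 1"
proof (rule ccontr)
  assume "\<not> ?thesis"
  then have eq: "u $ 1 * v $ 2 = v $ 1 * u $ 2"
    by (simp add: intersection_number_def mult.commute)
  then have "\<bar>u $ 1\<bar> * \<bar>v $ 2\<bar> = \<bar>v $ 1\<bar> * \<bar>u $ 2\<bar>"
    by (metis abs_mult)
  then have "\<bar>u $ 1\<bar> = \<bar>v $ 1\<bar> \<and> \<bar>v $ 2\<bar> = \<bar>u $ 2\<bar>"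
    using assms coprime_crossproduct_int[of "u $ 1" "u $ 2" "v $ 1" "v $ 2"]
    by (simp add: primitive_def)
  \<comment> \<open>The coordinates agree in absolute value; \<open>eq\<close> makes the two signs
    compatible.\<close>
  with eq assms(3) show False
    by (auto simp: curve_eq_iff int_vec2_eq_iff abs_eq_iff)
qed

section \<open>Normal forms of one to four curves\<close>

text \<open>Bezout coefficients of \<open>p\<close> form the first row; the second row annihilates
  \<open>p\<close>.\<close>

lemma SL2Z_normalize_primitive:
  assumes "primitive p"
  shows "\<exists>A\<in>SL2Z. A *v p = vector [1, 0]"
proof -
  obtain s t where "s * p $ 1 + t * p $ 2 = 1"
    using assms bezout_int[of "p $ 1" "p $ 2"] by (auto simp: primitive_def)
  then show ?thesis
    by (intro bexI[of _ "vector [vector [s, t], vector [- p $ 2, p $ 1]]"])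
      (auto simp: SL2Z_def det_2 int_vec2_eq_iff matrix_vector_mult_2)
qed

lemma SL2Z_normalize_pair:
  assumes "intersection_number p q = 1"
  shows "\<exists>A\<in>SL2Z. curve (A *v p) = curve (vector [1, 0]) \<and> curve (A *v q) = curve (vector [0, 1])"
proof -
  define e where "e = p $ 1 * q $ 2 - p $ 2 * q $ 1"
  have e: "e = 1 \<or> e = -1"
    using assms by (auto simp: intersection_number_def e_def)
  \<comment> \<open>The inverse of the matrix with columns \<open>p\<close> and
    \<open>e * q\<close>; the factor \<open>e\<close> corrects the determinant to
    \<open>e * e = 1\<close>, at the price of sending \<open>q\<close> to
    \<open>(0, e)\<close>.\<close>
  define A :: "int ^ 2 ^ 2"
    where "A = vector [vector [e * q $ 2, - e * q $ 1], vector [- p $ 2, p $ 1]]"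
  have "det A = e * e" "(A *v p) $ 1 = e * e" "(A *v p) $ 2 = 0" "(A *v q) $ 1 = 0" "(A *v q) $ 2 = e"
    by (simp_all add: A_def det_2 matrix_vector_mult_2 e_def algebra_simps)
  with e show ?thesis
    by (intro bexI[of _ A]) (auto simp: SL2Z_def int_vec2_eq_iff curve_eq_iff)
qed

text \<open>Crossing the two axis curves measures the absolute values of the coordinates of
  \<open>x\<close>.\<close>

lemma diagonal_curve_cases:
  assumes "intersection_number (vector [1, 0]) x = 1" and "intersection_number (vector [0, 1]) x = 1"
  shows "curve x = curve (vector [1, 1]) \<or> curve x = curve (vector [-1, 1])"
proof -
  have "\<bar>x $ 2\<bar> = 1" "\<bar>x $ 1\<bar> = 1"
    using assms by (simp_all add: intersection_number_def nat_eq_iff)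
  then show ?thesis
    by (auto simp: abs_eq_iff curve_eq_iff int_vec2_eq_iff)
qed

text \<open>With \<open>p\<close> and \<open>q\<close> on the axes, \<open>r\<close> is one of the
  two diagonals, and a rotation repairs the wrong choice.\<close>

lemma SL2Z_normalize_triple:
  assumes "intersection_number p q = 1" and "intersection_number p r = 1"
    and "intersection_number q r = 1"
  shows "\<exists>A\<in>SL2Z. {curve (A *v p), curve (A *v q), curve (A *v r)}
    = {curve (vector [1, 0]), curve (vector [0, 1]), curve (vector [1, 1])}"
proof -
  obtain A where A: "A \<in> SL2Z" and p: "curve (A *v p) = curve (vector [1, 0])"
      and q: "curve (A *v q) = curve (vector [0, 1])"
    using SL2Z_normalize_pair[OF assms(1)] by blast
  have "intersection_number (vector [1, 0]) (A *v r) = 1"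
      "intersection_number (vector [0, 1]) (A *v r) = 1"
    using assms(2,3) intersection_number_SL2Z[OF A]
    by (metis intersection_number_cong p, metis intersection_number_cong q)
  then consider "curve (A *v r) = curve (vector [1, 1])" | "curve (A *v r) = curve (vector [-1, 1])"
    using diagonal_curve_cases by blast
  then show ?thesis
  proof cases
    case 1
    with A p q show ?thesis by auto
  next
    case 2
    \<comment> \<open>The quarter turn: it swaps the axis curves and also the two diagonal
      curves.\<close>
    define B :: "int ^ 2 ^ 2" where "B = vector [vector [0, -1], vector [1, 0]]"
    have "det B = 1"
      by (simp add: B_def det_2)
    then have "B ** A \<in> SL2Z"
      using A by (simp add: SL2Z_def det_mul)
    moreover have "curve ((B ** A) *v p) = curve (vector [0, 1])"
        "curve ((B ** A) *v q) = curve (vector [1, 0])"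
        "curve ((B ** A) *v r) = curve (vector [1, 1])"
      using p q 2
      by (auto simp: curve_eq_iff int_vec2_eq_iff matrix_vector_mult_2 B_def
          simp flip: matrix_vector_mul_assoc)
    ultimately show ?thesis
      by (intro bexI[of _ "B ** A"]) auto
  qed
qed

text \<open>With \<open>p\<close> and \<open>q\<close> on the axes, only two diagonals are
  available, so \<open>r\<close> and \<open>s\<close> take both. Nothing is assumed about how often
  \<open>r\<close> and \<open>s\<close> cross, so the second conclusion can refute a system crossing
  pairwise once.\<close>

lemma SL2Z_normalize_quadruple:
  assumes "intersection_number p q = 1"
    and "intersection_number p r = 1" and "intersection_number q r = 1"
    and "intersection_number p s = 1" and "intersection_number q s = 1"
    and "curve r \<noteq> curve s"
  shows "\<exists>A\<in>SL2Z. {curve (A *v p), curve (A *v q), curve (A *v r), curve (A *v s)}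
    = {curve (vector [1, 0]), curve (vector [0, 1]), curve (vector [1, 1]), curve (vector [-1, 1])}"
    and "intersection_number r s = 2"
proof -
  obtain A where A: "A \<in> SL2Z" and p: "curve (A *v p) = curve (vector [1, 0])"
      and q: "curve (A *v q) = curve (vector [0, 1])"
    using SL2Z_normalize_pair[OF assms(1)] by blast
  have diag: "curve (A *v x) = curve (vector [1, 1]) \<or> curve (A *v x) = curve (vector [-1, 1])"
    if "intersection_number p x = 1" "intersection_number q x = 1" for x
  proof (rule diagonal_curve_cases)
    show "intersection_number (vector [1, 0]) (A *v x) = 1"
      using that(1) intersection_number_SL2Z[OF A] by (metis intersection_number_cong p)
    show "intersection_number (vector [0, 1]) (A *v x) = 1"
      using that(2) intersection_number_SL2Z[OF A] by (metis intersection_number_cong q)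
  qed
  have "curve (A *v r) \<noteq> curve (A *v s)"
    using curve_SL2Z_cancel[OF A] assms(6) by blast
  then consider "curve (A *v r) = curve (vector [1, 1])" "curve (A *v s) = curve (vector [-1, 1])"
    | "curve (A *v r) = curve (vector [-1, 1])" "curve (A *v s) = curve (vector [1, 1])"
    using diag assms(2-5) by metis
  note rs = this
  show "\<exists>A\<in>SL2Z. {curve (A *v p), curve (A *v q), curve (A *v r), curve (A *v s)}
    = {curve (vector [1, 0]), curve (vector [0, 1]), curve (vector [1, 1]), curve (vector [-1, 1])}"
    using A p q by (cases rule: rs) (auto intro!: bexI[of _ A])
  have "intersection_number (A *v r) (A *v s) = 2"
    by (cases rule: rs; subst intersection_number_cong, assumption, assumption)
      (simp_all add: intersection_number_def)
  then show "intersection_number r s = 2"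
    by (simp add: intersection_number_SL2Z[OF A])
qed

section \<open>Crossing numbers of systems of at most four curves\<close>

lemma
  shows atLeastAtMost_1_2: "{1..2::nat} = {1, 2}"
    and atLeastAtMost_1_3: "{1..3::nat} = {1, 2, 3}"
    and atLeastAtMost_1_4: "{1..4::nat} = {1, 2, 3, 4}"
  by auto

lemma crossing_number_1: "crossing_number 1 v = 0"
  by (simp add: crossing_number_def)

lemma crossing_number_Suc:
  "crossing_number (Suc k) v
    = crossing_number k v + (\<Sum>i\<in>{1..k}. intersection_number (v i) (v (Suc k)))"
  by (simp add: crossing_number_def atLeastLessThanSuc_atLeastAtMost)

lemma crossing_number_2: "crossing_number 2 v = intersection_number (v 1) (v 2)"
  using crossing_number_Suc[of 1 v] crossing_number_1[of v]
  by (simp add: numeral_2_eq_2)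

lemma crossing_number_3:
  "crossing_number 3 v = intersection_number (v 1) (v 2)
    + intersection_number (v 1) (v 3) + intersection_number (v 2) (v 3)"
  using crossing_number_Suc[of 2 v, unfolded atLeastAtMost_1_2] by (simp add: crossing_number_2)

lemma crossing_number_4:
  "crossing_number 4 v = intersection_number (v 1) (v 2)
    + intersection_number (v 1) (v 3) + intersection_number (v 2) (v 3)
    + intersection_number (v 1) (v 4) + intersection_number (v 2) (v 4)
    + intersection_number (v 3) (v 4)"
  using crossing_number_Suc[of 3 v, unfolded atLeastAtMost_1_3] by (simp add: crossing_number_3)

lemma curve_system_intersection_pos:
  assumes "curve_system k v" and "i \<in> {1..k}" and "j \<in> {1..k}" and "i \<noteq> j"
  shows "intersection_number (v i) (v j) \<ge> 1"
  using assms intersection_number_pos by (auto simp: curve_system_def)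

text \<open>Assuming only an upper bound serves two purposes: the first conclusion excludes fewer
  than seven crossings, the second classifies the minimal systems.\<close>

lemma four_curves_at_most_7_crossings:
  assumes v: "curve_system 4 v" and le: "crossing_number 4 v \<le> 7"
  shows "crossing_number 4 v = 7"
    and "\<exists>A\<in>SL2Z. (\<lambda>i. curve (A *v v i)) ` {1..4}
    = {curve (vector [1, 0]), curve (vector [0, 1]), curve (vector [1, 1]), curve (vector [-1, 1])}"
proof -
  let ?i = "\<lambda>a b. intersection_number (v a) (v b)"
  let ?W = "{curve (vector [1, 0]), curve (vector [0, 1]), curve (vector [1, 1]), curve (vector [-1, 1])}"
  have ne: "curve (v a) \<noteq> curve (v b)" if "a \<in> {1..4}" "b \<in> {1..4}" "a \<noteq> b" for a b
    using v that by (auto simp: curve_system_def)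
  \<comment> \<open>The alternative \<open>crossing_number 4 v = 6\<close> is contradictory: normalising the first pair
    shows that the complementary pair crosses twice.\<close>
  have step: "(\<exists>A\<in>SL2Z. (\<lambda>i. curve (A *v v i)) ` {1..4} = ?W) \<and> crossing_number 4 v = 7"
    if abcd: "{a, b, c, d} = {1..4}" "distinct [a, b, c, d]"
      and cr: "crossing_number 4 v = ?i a b + ?i a c + ?i b c + ?i a d + ?i b d + ?i c d"
      and big: "?i c d \<ge> 2 \<or> crossing_number 4 v = 6"
    for a b c d
  proof -
    have mem: "a \<in> {1..4}" "b \<in> {1..4}" "c \<in> {1..4}" "d \<in> {1..4}"
      unfolding abcd(1)[symmetric] by simp_all
    have "?i a b \<ge> 1" "?i a c \<ge> 1" "?i b c \<ge> 1" "?i a d \<ge> 1" "?i b d \<ge> 1" "?i c d \<ge> 1"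
      using mem abcd(2) by (auto intro!: curve_system_intersection_pos[OF v, unfolded One_nat_def])
    \<comment> \<open>Six pairs cross at least once and the total is at most seven, so
      \<open>big\<close> leaves no extra crossing for the five pairs other than \<open>c\<close>,
      \<open>d\<close>.\<close>
    then have one: "?i a b = 1" "?i a c = 1" "?i b c = 1" "?i a d = 1" "?i b d = 1"
      using le big cr by linarith+
    have "curve (v c) \<noteq> curve (v d)"
      using mem abcd(2) by (intro ne) auto
    note normal_form = SL2Z_normalize_quadruple[OF one this]
    have "(\<lambda>i. curve (A *v v i)) ` {1..4}
        = {curve (A *v v a), curve (A *v v b), curve (A *v v c), curve (A *v v d)}" for A
      by (subst abcd(1)[symmetric]) simp
    \<comment> \<open>\<open>normal_form\<close> gives \<open>?i c d = 2\<close>, so the total is 5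
      + 2.\<close>
    then show ?thesis
      using normal_form one cr by simp
  qed
  have pos: "?i 1 2 \<ge> 1" "?i 1 3 \<ge> 1" "?i 2 3 \<ge> 1" "?i 1 4 \<ge> 1" "?i 2 4 \<ge> 1" "?i 3 4 \<ge> 1"
    by (rule curve_system_intersection_pos[OF v]; simp)+
  \<comment> \<open>If no pair crosses twice, all six terms are one and the total is six.\<close>
  then have "?i 1 2 \<ge> 2 \<or> ?i 1 3 \<ge> 2 \<or> ?i 2 3 \<ge> 2 \<or> ?i 1 4 \<ge> 2 \<or> ?i 2 4 \<ge> 2
      \<or> (?i 3 4 \<ge> 2 \<or> crossing_number 4 v = 6)"
    unfolding crossing_number_4 by linarith
  then have "(\<exists>A\<in>SL2Z. (\<lambda>i. curve (A *v v i)) ` {1..4} = ?W) \<and> crossing_number 4 v = 7"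
  proof (elim disjE)
    assume "?i 1 2 \<ge> 2"
    then show ?thesis
      \<comment> \<open>In each case the pair crossing twice goes last, and its complement comes
        first to be normalised.\<close>
      by (intro step[of 3 4 1 2]) (auto simp: crossing_number_4 intersection_number_commute)
  next
    assume "?i 1 3 \<ge> 2"
    then show ?thesis
      by (intro step[of 2 4 1 3]) (auto simp: crossing_number_4 intersection_number_commute)
  next
    assume "?i 2 3 \<ge> 2"
    then show ?thesis
      by (intro step[of 1 4 2 3]) (auto simp: crossing_number_4 intersection_number_commute)
  next
    assume "?i 1 4 \<ge> 2"
    then show ?thesis
      by (intro step[of 2 3 1 4]) (auto simp: crossing_number_4 intersection_number_commute)
  next
    assume "?i 2 4 \<ge> 2"
    then show ?thesis
      by (intro step[of 1 3 2 4]) (auto simp: crossing_number_4 intersection_number_commute)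
  next
    assume "?i 3 4 \<ge> 2"
    then show ?thesis
      by (intro step[of 1 2 3 4]) (auto simp: crossing_number_4)
  next
    assume "crossing_number 4 v = 6"
    then show ?thesis
      by (intro step[of 1 2 3 4]) (auto simp: crossing_number_4)
  qed
  then show "crossing_number 4 v = 7" and "\<exists>A\<in>SL2Z. (\<lambda>i. curve (A *v v i)) ` {1..4} = ?W"
    by simp_all
qed

theorem lemma4p1:
  fixes w :: "nat \<Rightarrow> int ^ 2"
  assumes "w 1 = vector [1, 0]" and "w 2 = vector [0, 1]"
    and "w 3 = vector [1, 1]" and "w 4 = vector [-1, 1]"
  shows "(\<forall>k\<in>{1..4}. minimal_system k w) \<and>
    cr_torus 1 = 0 \<and> cr_torus 2 = 1 \<and> cr_torus 3 = 3 \<and> cr_torus 4 = 7 \<and>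
    (\<forall>k\<in>{1..4}. \<forall>v. minimal_system k v \<longrightarrow>
      (\<exists>A\<in>SL2Z. (\<lambda>i. curve (A *v v i)) ` {1..k} = (\<lambda>i. curve (w i)) ` {1..k}))"
proof -
  have "curve_system 4 w"
    unfolding curve_system_def atLeastAtMost_1_4
    \<comment> \<open>The simplifier rewrites the index \<open>1\<close> to \<open>Suc 0\<close>, so
      the hypotheses on \<open>w\<close> must be in that form to apply.\<close>
    by (simp add: assms[unfolded One_nat_def] primitive_def curve_eq_iff int_vec2_eq_iff)
  then have sys: "curve_system k w" if "k \<in> {1..4}" for k
    using that by (auto simp: curve_system_def)
  have cr: "crossing_number 1 w = 0" "crossing_number 2 w = 1" "crossing_number 3 w = 3"
      "crossing_number 4 w = 7"
    by (simp_all only: crossing_number_1 crossing_number_2 crossing_number_3 crossing_number_4 assms)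
      (simp_all add: intersection_number_def)
  have low2: "1 \<le> crossing_number 2 v" if "curve_system 2 v" for v
    using curve_system_intersection_pos[OF that, of 1 2] by (simp add: crossing_number_2)
  have low3: "3 \<le> crossing_number 3 v" if "curve_system 3 v" for v
    using curve_system_intersection_pos[OF that, of 1 2] curve_system_intersection_pos[OF that, of 1 3]
      curve_system_intersection_pos[OF that, of 2 3] by (simp add: crossing_number_3)
  have low4: "7 \<le> crossing_number 4 v" if "curve_system 4 v" for v
    \<comment> \<open>Any total of at most seven is exactly seven, so none is smaller.\<close>
    using four_curves_at_most_7_crossings(1)[OF that] by linarith
  have low: "crossing_number k w \<le> crossing_number k v" if "k \<in> {1..4}" "curve_system k v" for k v
    using that low2 low3 low4 cr unfolding atLeastAtMost_1_4 by auto
  have torus: "cr_torus k = crossing_number k w" if "k \<in> {1..4}" for k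
    unfolding cr_torus_def using sys[OF that] low[OF that] by (intro Least_equality) auto
  have "\<exists>A\<in>SL2Z. (\<lambda>i. curve (A *v v i)) ` {1..k} = (\<lambda>i. curve (w i)) ` {1..k}"
    if k: "k \<in> {1..4}" and min: "minimal_system k v" for k v
  proof -
    have v: "curve_system k v" and crv: "crossing_number k v = crossing_number k w"
      using min torus[OF k] by (simp_all add: minimal_system_def)
    note pos = curve_system_intersection_pos[OF v]
    consider "k = 1" | "k = 2" | "k = 3" | "k = 4"
      using k by fastforce
    then show ?thesis
    proof cases
      case 1
      then have "primitive (v 1)"
        using v by (simp add: curve_system_def)
      then obtain A where "A \<in> SL2Z" "A *v v 1 = w 1"
        using SL2Z_normalize_primitive assms(1) by metis
      then show ?thesis
        by (intro bexI[of _ A]) (simp_all add: 1)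
    next
      case 2
      then have "intersection_number (v 1) (v 2) = 1"
        using crv cr by (simp add: crossing_number_2)
      then obtain A where "A \<in> SL2Z" "curve (A *v v 1) = curve (w 1)" "curve (A *v v 2) = curve (w 2)"
        using SL2Z_normalize_pair assms(1,2) by metis
      then show ?thesis
        by (intro bexI[of _ A]) (simp_all add: 2 atLeastAtMost_1_2[unfolded One_nat_def])
    next
      case 3
      then have "intersection_number (v 1) (v 2) = 1" "intersection_number (v 1) (v 3) = 1"
          "intersection_number (v 2) (v 3) = 1"
        \<comment> \<open>Three terms, each at least one, add up to three.\<close>
        using crv cr pos[of 1 2] pos[of 1 3] pos[of 2 3] by (simp_all add: crossing_number_3)
      then show ?thesis
        using SL2Z_normalize_triple[of "v 1" "v 2" "v 3"]
        unfolding 3 atLeastAtMost_1_3 by (simp add: assms[unfolded One_nat_def])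
    next
      case 4
      then show ?thesis
        using four_curves_at_most_7_crossings(2)[of v] v crv cr
        by (simp add: assms[unfolded One_nat_def] atLeastAtMost_1_4[unfolded One_nat_def])
    qed
  qed
  then show ?thesis
    using sys torus cr by (simp add: minimal_system_def)
qed

end
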